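(* Let $f\in\mathcal{S}$ with $f(z)=z+a_2z^2+a_3z^3+\cdots$ and $a_2\neq 0$. Then the function $$g(z)=\frac{(z/f(z))-1}{-a_2}$$ belongs to the class $\mathcal{U}$ in the disc $|z|<r_0$, where $r_0$ is the unique real root of the equation $$\frac{3r^2-2r^4}{(1-r^2)^2}-\ln(1-r^2)=|a_2|^2$$ on the interval $(0,1)$.
   Context: Let $\mathbb{D}=\{z\in\mathbb{C}:|z|<1\}$. $\mathcal{A}$ is the family of all analytic functions $f$ in $\mathbb{D}$ with $f(0)=0=f'(0)-1$, i.e. $f(z)=z+a_2z^2+a_3z^3+\cdots$. $\mathcal{S}\subset\mathcal{A}$ is the class of functions in $\mathcal{A}$ that are univalent (injective) in $\mathbb{D}$. The quotient $z/f(z)$ is given the value $1$ at $z=0$. For $0<R\leq1$, a function $g$ analytic in $\mathbb{D}$ with $g(0)=0=g'(0)-1$ is said to belong to $\mathcal{U}$ in the disc $|z|<R$ if $g(z)\neq0$ for $0<|z|<R$ and $\left|\left(\frac{z}{g(z)}\right)^2g'(z)-1\right|<1$ for all $|z|<R$, where $z/g(z)$ is given the value $1$ at $z=0$. *)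

theory Defs
  imports "HOL-Complex_Analysis.Complex_Analysis"
begin

definition class_A :: "(complex \<Rightarrow> complex) set" where
  "class_A = {f. f analytic_on ball 0 1 \<and> f 0 = 0 \<and> deriv f 0 = 1}"

definition class_S :: "(complex \<Rightarrow> complex) set" where
  "class_S = {f \<in> class_A. inj_on f (ball 0 1)}"

abbreviation taylor_coeff :: "(complex \<Rightarrow> complex) \<Rightarrow> nat \<Rightarrow> complex" where
  "taylor_coeff f n \<equiv> fps_nth (fps_expansion f 0) n"

(* The explicit value 1 fills the removable singularity at 0, where HOL would give 0 / 0 = 0. *)
definition z_over :: "(complex \<Rightarrow> complex) \<Rightarrow> complex \<Rightarrow> complex" where
  "z_over f z = (if z = 0 then 1 else z / f z)"

(* Membership in U in the disc of radius R about 0, for 0 < R \<le> 1; analyticity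
   is required in the whole unit disc. *)
definition class_U_in_disc :: "real \<Rightarrow> (complex \<Rightarrow> complex) set" where
  "class_U_in_disc R = {g \<in> class_A.
     (\<forall>z. 0 < norm z \<and> norm z < R \<longrightarrow> g z \<noteq> 0) \<and>
     (\<forall>z. norm z < R \<longrightarrow> norm ((z_over g z)\<^sup>2 * deriv g z - 1) < 1)}"

definition radius_fun :: "real \<Rightarrow> real" where
  "radius_fun r = (3 * r\<^sup>2 - 2 * r ^ 4) / (1 - r\<^sup>2)\<^sup>2 - ln (1 - r\<^sup>2)"

end

theory Submission
  imports Defs
begin

text \<open>
  Write \<open>z / f z = 1 + b\<^sub>1 z + b\<^sub>2 z\<^sup>2 + \<dots>\<close>, so \<open>b\<^sub>1 = - a\<^sub>2\<close>, and \<open>e = b\<^sub>2 z\<^sup>2 + b\<^sub>3 z\<^sup>3 + \<dots>\<close>.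
  The condition for \<open>g\<close> to lie in the class \<open>\<U>\<close> follows from \<open>|z e' - 2 e| + 2 |e| < |b\<^sub>1 z|\<close>, hence
  from \<open>\<Sum>n\<ge>2. n |b\<^sub>n| r\<^sup>n\<^sup>-\<^sup>1 < |b\<^sub>1|\<close>. By Cauchy-Schwarz the square of this sum is at most the product of
  \<open>\<Sum>n\<ge>2. (n - 1) |b\<^sub>n|\<^sup>2\<close>, which Gronwall's area theorem bounds by 1, and of
  \<open>\<Sum>n\<ge>2. n\<^sup>2 / (n - 1) r\<^sup>2\<^sup>n\<^sup>-\<^sup>2\<close>, which is the left-hand side of the equation for \<open>r\<^sub>0\<close>.

  For the area theorem the injective function \<open>1 / f\<close> is considered on the annulus \<open>\<rho> < |z| < R\<close>.
  The circle of radius \<open>\<rho>\<close> is mapped to within \<open>O(\<rho>\<^sup>2)\<close> of an ellipse, and the area enclosed by this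
  ellipse bounds, up to \<open>O(\<rho>)\<close>, the area of the image, that is, the integral of \<open>|(1 / f)'|\<^sup>2\<close>.
  No boundary curve has to be integrated: a real-linear map turns the ellipse into a circle, and the
  transformed image lies in a disc.
\<close>

section \<open>Power series on circles\<close>

lemma sums_taylor:
  fixes f :: "complex \<Rightarrow> complex"
  assumes "f holomorphic_on ball 0 r" "f has_fps_expansion F" "norm z < r"
  shows "(\<lambda>n. fps_nth F n * z ^ n) sums f z"
proof -
  have "(\<lambda>n. (deriv ^^ n) f 0 / fact n * (z - 0) ^ n) sums f z"
    by (rule holomorphic_power_series) (use assms in auto)
  then show ?thesis
    by (simp add: fps_nth_fps_expansion[OF assms(2)])
qed

text \<open>Cauchy's formula for the m-th derivative, with the circle parametrised by the angle. On
  the unit circle the inverse of \<open>cis t ^ m\<close> is its conjugate, so dividing by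
  \<open>u ^ Suc m\<close> amounts to taking a Fourier coefficient.\<close>

lemma fourier_coeff_circle:
  fixes f :: "complex \<Rightarrow> complex"
  assumes hol: "f holomorphic_on ball 0 1" and F: "f has_fps_expansion F" and s: "0 < s" "s < 1"
  shows "((\<lambda>t. f (of_real s * cis t) * cnj (cis t ^ m)) has_integral 
     (of_real (2 * pi) * fps_nth F m * of_real s ^ m)) {0..2*pi}"
proof -
  have sub: "cball 0 s \<subseteq> (ball 0 1 :: complex set)" using s by auto
  have "((\<lambda>u. f u / (u - 0) ^ Suc m) has_contour_integral 2 * pi * \<i> / fact m * (deriv ^^ m) f 0)
          (circlepath 0 s)"
    by (rule Cauchy_has_contour_integral_higher_derivative_circlepath)
       (use s sub hol in \<open>auto intro: holomorphic_on_subset holomorphic_on_imp_continuous_on\<close>)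
  then have "((\<lambda>u. f u / u ^ Suc m) has_contour_integral 2 * pi * \<i> * fps_nth F m)
          (part_circlepath 0 s 0 (2*pi))"
    by (simp add: fps_nth_fps_expansion[OF F] circlepath_def)
  then have "((\<lambda>t. f (0 + s * cis t) / (0 + s * cis t) ^ Suc m * s * \<i> * cis t) 
     has_integral 2 * pi * \<i> * fps_nth F m) {0..2*pi}"
    by (subst (asm) has_contour_integral_part_circlepath_iff) auto
  then have "((\<lambda>t. (s ^ m / \<i>) * (f (0 + s * cis t) / (0 + s * cis t) ^ Suc m * s * \<i> * cis t)) 
     has_integral (s ^ m / \<i>) * (2 * pi * \<i> * fps_nth F m)) {0..2*pi}"
    by (rule has_integral_mult_right)
  moreover have "(s ^ m / \<i>) * (f (0 + s * cis t) / (0 + s * cis t) ^ Suc m * s * \<i> * cis t) = 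
     f (of_real s * cis t) * cnj (cis t ^ m)" for t
  proof -
    have "cnj (cis t ^ m) = inverse (cis t ^ m)"
      by (metis cis_cnj cis_inverse complex_cnj_power power_inverse)
    then show ?thesis
      using s by (simp add: field_simps power_mult_distrib)
  qed
  ultimately show ?thesis by (simp add: mult_ac)
qed

text \<open>Bessel's inequality for the Taylor polynomial \<open>P\<close> of degree
  \<open>N\<close>: integrate \<open>0 \<le> |f - P|^2\<close> over the circle. A finite sum is
  enough for the area theorem, so no limit has to be exchanged with the integral.\<close>

lemma bessel_circle:
  assumes hol: "f holomorphic_on ball 0 1" and F: "f has_fps_expansion F" and s: "0 < s" "s < 1"
  shows "2 * pi * (\<Sum>m\<le>N. (norm (fps_nth F m))\<^sup>2 * s ^ (2*m)) \<le>
     integral {0..2*pi} (\<lambda>t. (norm (f (of_real s * cis t)))\<^sup>2)"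
proof -
  define P where "P = (\<lambda>z. \<Sum>m\<le>N. fps_nth F m * z ^ m)"
  define A where "A = (\<Sum>m\<le>N. (norm (fps_nth F m))\<^sup>2 * s ^ (2*m))"
  have P_fps: "P has_fps_expansion (\<Sum>m\<le>N. fps_const (fps_nth F m) * fps_X ^ m)"
    unfolding P_def by (intro fps_expansion_intros)
  have P_nth: "fps_nth (\<Sum>m\<le>N. fps_const (fps_nth F m) * fps_X ^ m) n = fps_nth F n" if "n \<le> N" for n
    using that by (simp add: fps_sum_nth if_distrib[of "\<lambda>x. _ * x"] cong: if_cong)
  have P_hol: "P holomorphic_on ball 0 1"
    unfolding P_def by (intro holomorphic_intros)
  \<comment> \<open>Only the coefficients up to \<open>N\<close> enter the inner product with
    \<open>P\<close>. Taking \<open>g\<close> to be \<open>f\<close> and then \<open>P\<close> shows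
    that both inner products have the same value \<open>2 * pi * A\<close>.\<close>
  have cross: "((\<lambda>t. Re (g (of_real s * cis t) * cnj (P (of_real s * cis t)))) has_integral 2 * pi * A) {0..2*pi}"
    if g: "g holomorphic_on ball 0 1" "g has_fps_expansion G" "\<And>n. n \<le> N \<Longrightarrow> fps_nth G n = fps_nth F n" for g G
  proof -
    have "((\<lambda>t. \<Sum>m\<le>N. cnj (fps_nth F m * of_real s ^ m) * (g (of_real s * cis t) * cnj (cis t ^ m))) has_integral 
        (\<Sum>m\<le>N. cnj (fps_nth F m * of_real s ^ m) * (of_real (2 * pi) * fps_nth G m * of_real s ^ m))) {0..2*pi}"
      by (intro has_integral_sum has_integral_mult_right fourier_coeff_circle g s finite_atMost)
    also have "(\<Sum>m\<le>N. cnj (fps_nth F m * of_real s ^ m) * (of_real (2 * pi) * fps_nth G m * of_real s ^ m)) = of_real (2 * pi * A)"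
      unfolding A_def sum_distrib_left of_real_sum
    proof (intro sum.cong refl)
      fix m assume "m \<in> {..N}"
      then have G: "fps_nth G m = fps_nth F m"
        using g(3) by simp
      have S: "of_real (s ^ (2 * m)) = (of_real s ^ m * of_real s ^ m :: complex)"
        unfolding mult_2 power_add by simp
      have "cnj (fps_nth F m * of_real s ^ m) * (of_real (2 * pi) * fps_nth F m * of_real s ^ m) =
          of_real (2 * pi) * (fps_nth F m * cnj (fps_nth F m)) * of_real (s ^ (2 * m))"
        unfolding S complex_cnj_mult complex_cnj_power complex_cnj_complex_of_real by (simp only: mult_ac)
      also have "\<dots> = of_real (2 * pi * ((norm (fps_nth F m))\<^sup>2 * s ^ (2 * m)))"
        unfolding complex_norm_square[symmetric] by simp
      finally show "cnj (fps_nth F m * of_real s ^ m) * (of_real (2 * pi) * fps_nth G m * of_real s ^ m) =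
          of_real (2 * pi * ((norm (fps_nth F m))\<^sup>2 * s ^ (2 * m)))"
        unfolding G .
    qed
    also have "(\<lambda>t. \<Sum>m\<le>N. cnj (fps_nth F m * of_real s ^ m) * (g (of_real s * cis t) * cnj (cis t ^ m))) = 
       (\<lambda>t. g (of_real s * cis t) * cnj (P (of_real s * cis t)))"
      unfolding P_def cnj_sum sum_distrib_left by (intro ext sum.cong refl) (simp add: power_mult_distrib)
    finally show ?thesis
      using has_integral_Re[of _ "of_real (2 * pi * A)"] by (simp only: Re_complex_of_real)
  qed
  have circ: "of_real s * cis t \<in> ball 0 1" for t
    using s by (simp add: norm_mult)
  have cont: "continuous_on {0..2*pi} (\<lambda>t. (norm (f (of_real s * cis t)))\<^sup>2)"
    by (intro continuous_intros continuous_on_compose2[OF holomorphic_on_imp_continuous_on[OF hol]])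
       (use circ in auto)
  have 1: "((\<lambda>t. 2 * Re (f (of_real s * cis t) * cnj (P (of_real s * cis t))) - 
          Re (P (of_real s * cis t) * cnj (P (of_real s * cis t)))) has_integral 2 * (2 * pi * A) - 2 * pi * A) {0..2*pi}"
    by (intro has_integral_diff has_integral_mult_right cross[OF hol F] cross[OF P_hol P_fps] P_nth refl)
  have le: "2 * Re (a * cnj b) - Re (b * cnj b) \<le> (norm a)\<^sup>2" for a b :: complex
  proof -
    have "0 \<le> (norm (a - b))\<^sup>2" by simp
    also have "\<dots> = (norm a)\<^sup>2 - (2 * Re (a * cnj b) - Re (b * cnj b))"
      unfolding cmod_power2 by (simp add: power2_eq_square algebra_simps)
    finally show ?thesis by simp
  qed
  have "2 * (2 * pi * A) - 2 * pi * A \<le> integral {0..2*pi} (\<lambda>t. (norm (f (of_real s * cis t)))\<^sup>2)"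
    by (rule has_integral_le[OF 1 integrable_integral[OF integrable_continuous_real[OF cont]]]) (rule le)
  then show ?thesis by (simp add: A_def)
qed

lemma powser_remainder_bound:
  fixes f :: "complex \<Rightarrow> complex"
  assumes sums: "\<And>z. norm z < 1 \<Longrightarrow> (\<lambda>n. a n * z ^ n) sums f z" and R: "0 < R" "R < 1"
  obtains K where "0 \<le> K" "\<And>z. norm z \<le> R \<Longrightarrow> norm (f z - (\<Sum>n<k. a n * z ^ n)) \<le> K * norm z ^ k"
proof
  define K where "K = (\<Sum>n. norm (a (n + k)) * R ^ n)"
  \<comment> \<open>Convergence at a radius strictly beyond \<open>R\<close> yields absolute
    convergence at \<open>R\<close>, hence one constant \<open>K\<close> for the whole closed
    disc.\<close>
  obtain R' where R': "R < R'" "R' < 1"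
    using R dense by blast
  have "summable (\<lambda>n. a n * of_real R' ^ n)"
    using sums[of "of_real R'"] R R' sums_summable by auto
  then have "summable (\<lambda>n. norm (a n * of_real R ^ n))"
    by (rule powser_insidea) (use R R' in auto)
  then have "summable (\<lambda>n. norm (a (n + k) * of_real R ^ (n + k)) / R ^ k)"
    by (intro summable_divide) (rule summable_iff_shift[THEN iffD2])
  then have summ: "summable (\<lambda>n. norm (a (n + k)) * R ^ n)"
    using R by (simp add: norm_mult norm_power power_add)
  show "0 \<le> K"
    unfolding K_def using R by (intro suminf_nonneg summ) auto
  fix z :: complex assume z: "norm z \<le> R"
  have "(\<lambda>n. a (n + k) * z ^ (n + k)) sums (f z - (\<Sum>n<k. a n * z ^ n))"
    using sums[of z] z R by (intro sums_split_initial_segment) auto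
  moreover have "(\<lambda>n. norm z ^ k * (norm (a (n + k)) * R ^ n)) sums (norm z ^ k * K)"
    unfolding K_def by (intro sums_mult summable_sums summ)
  moreover have "norm (a (n + k) * z ^ (n + k)) \<le> norm z ^ k * (norm (a (n + k)) * R ^ n)" for n
  proof -
    have "norm z ^ n \<le> R ^ n"
      using z by (intro power_mono) auto
    then have "norm z ^ k * (norm (a (n + k)) * norm z ^ n) \<le> norm z ^ k * (norm (a (n + k)) * R ^ n)"
      by (intro mult_left_mono) auto
    then show ?thesis
      by (simp add: norm_mult norm_power power_add mult_ac)
  qed
  ultimately show "norm (f z - (\<Sum>n<k. a n * z ^ n)) \<le> K * norm z ^ k"
    using norm_suminf_le[of "\<lambda>n. a (n + k) * z ^ (n + k)" "\<lambda>n. norm z ^ k * (norm (a (n + k)) * R ^ n)"]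
    by (simp add: sums_iff mult.commute)
qed

section \<open>The area theorem\<close>

text \<open>Bridge between iterated integrals, which belong to pairs of reals, and the area formula
  for differentiable images, which is applied on \<open>real^2\<close>. The identification of the
  two planes preserves the content of boxes.\<close>

lemma integral_cart2:
  fixes f :: "real \<Rightarrow> real \<Rightarrow> real"
  assumes cont: "continuous_on (cbox (a, c) (b, d)) (\<lambda>(x, y). f x y)"
  shows "((\<lambda>v. f (v $ 1) (v $ 2)) has_integral 
     integral {a..b} (\<lambda>x. integral {c..d} (f x))) (cbox (vector [a, c]) (vector [b, d] :: real^2))"
proof -
  define g :: "real^2 \<Rightarrow> real \<times> real" where "g = (\<lambda>v. (v $ 1, v $ 2))"
  define h :: "real \<times> real \<Rightarrow> real^2" where "h = (\<lambda>(x, y). vector [x, y])"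
  have hg: "h (g x) = x" for x
    by (simp add: h_def g_def vec_eq_iff forall_2)
  have gh: "g (h x) = x" for x
    by (simp add: h_def g_def split: prod.splits)
  have g_cbox: "g ` cbox u v = cbox (u $ 1, u $ 2) (v $ 1, v $ 2)" for u v
  proof (intro equalityI subsetI)
    fix p assume "p \<in> cbox (u $ 1, u $ 2) (v $ 1, v $ 2)"
    then have "h p \<in> cbox u v"
      by (cases p) (auto simp: h_def mem_box_cart forall_2)
    then show "p \<in> g ` cbox u v"
      using gh by (metis image_eqI)
  qed (auto simp: g_def mem_box_cart forall_2)
  have h_cbox: "h ` cbox (p, q) (r, s) = cbox (vector [p, q]) (vector [r, s])" for p q r s
  proof -
    have "cbox (p, q) (r, s) = g ` cbox (vector [p, q]) (vector [r, s])"
      by (simp add: g_cbox)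
    then show ?thesis
      by (simp add: image_image hg)
  qed
  have "((\<lambda>v. (\<lambda>(x, y). f x y) (g v)) has_integral 
     (1/1) *\<^sub>R integral (cbox (a, c) (b, d)) (\<lambda>(x, y). f x y)) (h ` cbox (a, c) (b, d))"
  proof (rule has_integral_twiddle[OF _ hg gh])
    show "isCont g x" for x
      unfolding g_def by (intro continuous_intros)
    show "\<exists>w z. g ` cbox u v = cbox w z" for u v
      using g_cbox by blast
    show "\<exists>w z. h ` cbox u v = cbox w z" for u v
      using h_cbox by (metis surj_pair)
    show "measure lborel (g ` cbox u v) = 1 * measure lborel (cbox u v)" for u v
    proof -
      have "measure lborel (cbox u v) = (if cbox u v = {} then 0 else \<Prod>i\<in>UNIV. v $ i - u $ i)"
        by (rule content_cbox_if_cart)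
      moreover have "cbox u v = {} \<longleftrightarrow> v $ 1 < u $ 1 \<or> v $ 2 < u $ 2"
        using forall_2[of "\<lambda>i. \<not> v $ i < u $ i"] unfolding interval_eq_empty_cart by blast
      moreover have "measure lborel {x..y :: real} = (if y < x then 0 else y - x)" for x y
        by simp
      ultimately show ?thesis
        unfolding g_cbox content_Pair by (auto simp: UNIV_2)
    qed
    show "((\<lambda>(x, y). f x y) has_integral integral (cbox (a, c) (b, d)) (\<lambda>(x, y). f x y)) (cbox (a, c) (b, d))"
      by (intro integrable_integral integrable_continuous cont)
  qed auto
  then show ?thesis
    by (simp add: h_cbox g_def integral_prod_continuous[OF cont])
qed

section \<open>Upper bound for the area of the image\<close>

text \<open>The real-linear map \<open>L z = z - \<beta> * cnj z\<close> is injective with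
  determinant \<open>1 - |\<beta>|^2\<close>, so the left-hand side is the area of the image of the
  open rectangle under \<open>L\<close> after \<open>h\<close>, and this image lies in a disc of
  radius \<open>M\<close>. Injectivity is asked only in the open rectangle because in logarithmic
  coordinates two opposite edges have the same image.\<close>

lemma area_twisted_image_le:
  fixes h :: "complex \<Rightarrow> complex"
  assumes hol: "h holomorphic_on U" and U: "open U"
    and sub: "\<And>x y. x \<in> {a..b} \<Longrightarrow> y \<in> {c..d} \<Longrightarrow> Complex x y \<in> U"
    and inj: "\<And>x y x' y'. \<lbrakk>x \<in> {a<..<b}; y \<in> {c<..<d}; x' \<in> {a<..<b}; y' \<in> {c<..<d}; h (Complex x y) = h (Complex x' y')\<rbrakk>
       \<Longrightarrow> x = x' \<and> y = y'"
    and bound: "\<And>x y. x \<in> {a<..<b} \<Longrightarrow> y \<in> {c<..<d} \<Longrightarrow> norm (h (Complex x y) - \<beta> * cnj (h (Complex x y))) \<le> M"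
    and \<beta>: "norm \<beta> < 1" and M: "0 \<le> M"
  shows "(1 - (norm \<beta>)\<^sup>2) * integral {a..b} (\<lambda>x. integral {c..d} (\<lambda>y. (norm (deriv h (Complex x y)))\<^sup>2)) \<le> pi * M\<^sup>2"
proof -
  define \<zeta> :: "real^2 \<Rightarrow> complex" where "\<zeta> = (\<lambda>v. Complex (v $ 1) (v $ 2))"
  define w :: "complex \<Rightarrow> real^2" where "w = (\<lambda>z. vector [Re z, Im z])"
  define L where "L = (\<lambda>z. z - \<beta> * cnj z)"
  define S :: "(real^2) set" where "S = box (vector [a, c]) (vector [b, d])"
  define \<Phi> where "\<Phi> = (\<lambda>v. w (L (h (\<zeta> v))))"
  define \<Phi>' where "\<Phi>' = (\<lambda>v u. w (L (deriv h (\<zeta> v) * \<zeta> u)))"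
  have S: "v \<in> S \<longleftrightarrow> v $ 1 \<in> {a<..<b} \<and> v $ 2 \<in> {c<..<d}" for v
    by (auto simp: S_def mem_box_cart forall_2)
  have lin_\<zeta>: "bounded_linear \<zeta>"
    by (intro linear_conv_bounded_linear[THEN iffD1] linearI) (auto simp: \<zeta>_def complex_eq_iff)
  have lin_w: "bounded_linear w"
    by (intro linear_conv_bounded_linear[THEN iffD1] linearI) (auto simp: w_def vec_eq_iff forall_2)
  have lin_L: "bounded_linear L"
    by (intro linear_conv_bounded_linear[THEN iffD1] linearI) (auto simp: L_def algebra_simps)
  \<comment> \<open>The columns of the matrix are the images of 1 and \<open>\<i>\<close>.
    Multiplication by \<open>D\<close> contributes the factor \<open>|D|^2\<close>, and
    \<open>L\<close> the factor \<open>1 - |\<beta>|^2\<close>.\<close>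
  have det: "\<bar>det (matrix (\<Phi>' v))\<bar> = (1 - (norm \<beta>)\<^sup>2) * (norm (deriv h (\<zeta> v)))\<^sup>2" for v
  proof -
    define D where "D = deriv h (\<zeta> v)"
    have ax: "\<zeta> (axis 1 1) = 1" "\<zeta> (axis 2 1) = \<i>"
      by (auto simp: \<zeta>_def axis_def complex_eq_iff)
    have "det (matrix (\<Phi>' v)) = Re (L D) * Im (L (D * \<i>)) - Re (L (D * \<i>)) * Im (L D)"
      by (simp add: det_2 matrix_def \<Phi>'_def ax w_def D_def)
    also have "\<dots> = (1 - (norm \<beta>)\<^sup>2) * (norm D)\<^sup>2"
      unfolding cmod_power2 by (simp add: L_def power2_eq_square algebra_simps)
    finally have "det (matrix (\<Phi>' v)) = (1 - (norm \<beta>)\<^sup>2) * (norm D)\<^sup>2" .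
    moreover have "0 \<le> 1 - (norm \<beta>)\<^sup>2"
      using \<beta> by (simp add: power_le_one)
    ultimately show ?thesis
      by (simp add: D_def)
  qed
  have der: "(\<Phi> has_derivative \<Phi>' v) (at v within S)" if "v \<in> S" for v
  proof -
    have "\<zeta> v \<in> U"
      using that sub by (auto simp: S \<zeta>_def)
    then have "(h has_derivative (*) (deriv h (\<zeta> v))) (at (\<zeta> v))"
      using holomorphic_derivI[OF hol U] by (simp add: has_field_derivative_def)
    then have "((\<lambda>v. h (\<zeta> v)) has_derivative (\<lambda>u. deriv h (\<zeta> v) * \<zeta> u)) (at v within S)"
      by (rule has_derivative_compose[OF bounded_linear_imp_has_derivative[OF lin_\<zeta>]])
    then show ?thesis
      unfolding \<Phi>_def \<Phi>'_def
      by (intro bounded_linear.has_derivative[OF lin_w] bounded_linear.has_derivative[OF lin_L])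
  qed
  have inj_L: "z = z'" if "L z = L z'" for z z'
  proof (rule ccontr)
    assume "z \<noteq> z'"
    have "z - z' = \<beta> * cnj (z - z')"
      using that by (simp add: L_def algebra_simps)
    then have "norm (z - z') = norm \<beta> * norm (z - z')"
      by (metis complex_mod_cnj norm_mult)
    with \<beta> \<open>z \<noteq> z'\<close> show False by simp
  qed
  have inj_\<Phi>: "inj_on \<Phi> S"
  proof (rule inj_onI)
    fix u v assume *: "u \<in> S" "v \<in> S" "\<Phi> u = \<Phi> v"
    then have "L (h (\<zeta> u)) = L (h (\<zeta> v))"
      by (simp add: \<Phi>_def w_def vec_eq_iff forall_2 complex_eq_iff)
    then have "h (\<zeta> u) = h (\<zeta> v)"
      by (rule inj_L)
    with * inj[of "u$1" "u$2" "v$1" "v$2"] show "u = v"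
      by (simp add: S \<zeta>_def vec_eq_iff forall_2)
  qed
  define I where "I = integral {a..b} (\<lambda>x. integral {c..d} (\<lambda>y. (norm (deriv h (Complex x y)))\<^sup>2))"
  have cont: "continuous_on (cbox (a, c) (b, d)) (\<lambda>(x, y). (norm (deriv h (Complex x y)))\<^sup>2)"
  proof -
    have "deriv h holomorphic_on U"
      using hol U by (rule holomorphic_deriv)
    then have "continuous_on U (deriv h)"
      by (rule holomorphic_on_imp_continuous_on)
    moreover have "continuous_on (cbox (a, c) (b, d)) (\<lambda>p. Complex (fst p) (snd p))"
      unfolding Complex_eq by (intro continuous_intros)
    moreover have "(\<lambda>p. Complex (fst p) (snd p)) ` cbox (a, c) (b, d) \<subseteq> U"
      using sub by auto
    ultimately have "continuous_on (cbox (a, c) (b, d)) (\<lambda>p. deriv h (Complex (fst p) (snd p)))"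
      by (rule continuous_on_compose2)
    then show ?thesis
      unfolding case_prod_unfold by (intro continuous_intros)
  qed
  have "((\<lambda>v. (norm (deriv h (\<zeta> v)))\<^sup>2) has_integral I) S"
    unfolding S_def has_integral_open_interval I_def \<zeta>_def
    using integral_cart2[OF cont] by simp
  then have "((\<lambda>v. \<bar>det (matrix (\<Phi>' v))\<bar>) has_integral (1 - (norm \<beta>)\<^sup>2) * I) S"
    unfolding det by (rule has_integral_mult_right)
  moreover have "S \<in> sets lebesgue"
    unfolding S_def by simp
  ultimately have meas: "\<Phi> ` S \<in> lmeasurable" and "measure lebesgue (\<Phi> ` S) = (1 - (norm \<beta>)\<^sup>2) * I"
    using has_measure_differentiable_image[OF _ der inj_\<Phi>] by blast+
  moreover have "measure lebesgue (\<Phi> ` S) \<le> measure lebesgue (cball 0 M :: (real^2) set)"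
  proof (rule measure_mono_fmeasurable)
    show "\<Phi> ` S \<subseteq> cball 0 M"
    proof clarify
      fix v assume "v \<in> S"
      have "norm (w z) = norm z" for z
        by (simp add: w_def norm_vec_def L2_set_def UNIV_2 cmod_def)
      then show "\<Phi> v \<in> cball 0 M"
        using bound[of "v$1" "v$2"] \<open>v \<in> S\<close> by (simp add: \<Phi>_def S \<zeta>_def L_def)
    qed
  qed (use meas in \<open>auto simp: fmeasurableD\<close>)
  moreover have "measure lebesgue (cball 0 M :: (real^2) set) = pi * M\<^sup>2"
    using M by (simp add: content_cball unit_ball_vol_2)
  ultimately show ?thesis
    by (simp add: I_def)
qed

text \<open>On the circle of radius \<open>\<rho>\<close> one has
  \<open>\<rho>^2 / cnj z = z\<close>, so the twist cancels \<open>b * z\<close> exactly. Farther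
  out a part of \<open>b * z\<close> survives, but \<open>1 / norm z\<close> has dropped below
  \<open>1 / \<rho>\<close> by more than that; this is what \<open>small\<close> guarantees.\<close>

lemma twisted_norm_bound:
  fixes z b k :: complex
  assumes s: "0 < \<rho>" "\<rho> \<le> norm z" "norm z \<le> 1" and k: "norm k \<le> K * (norm z)\<^sup>2"
    and small: "2 * (norm b + K) * \<rho> \<le> 1" and K: "0 \<le> K"
  defines "w \<equiv> 1 / z + b * z + k"
  shows "norm (w - b * of_real (\<rho>\<^sup>2) * cnj w) \<le> 1 / \<rho> + (K + norm b * (norm b + K)) * \<rho>\<^sup>2"
proof -
  define s where "s = norm z"
  define B where "B = norm b"
  have s': "0 < s" "\<rho> \<le> s" "s \<le> 1" and B: "0 \<le> B"
    using s by (auto simp: s_def B_def)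
  have "z \<noteq> 0" using s by auto
  have zz: "z * cnj z = of_real (s\<^sup>2)"
    unfolding s_def by (rule complex_norm_square[symmetric])
  have "w - b * of_real (\<rho>\<^sup>2) * cnj w = 
     1 / z + (b * z - b * of_real (\<rho>\<^sup>2) / cnj z) + k - b * of_real (\<rho>\<^sup>2) * (cnj b * cnj z + cnj k)"
    by (simp add: w_def algebra_simps)
  also have "b * z - b * of_real (\<rho>\<^sup>2) / cnj z = b * z * of_real (1 - \<rho>\<^sup>2 / s\<^sup>2)"
  proof -
    have "1 / cnj z = z / of_real (s\<^sup>2)"
      using zz \<open>z \<noteq> 0\<close> \<open>0 < s\<close> by (simp add: divide_simps mult.commute)
    then have "b * of_real (\<rho>\<^sup>2) / cnj z = b * of_real (\<rho>\<^sup>2) * (z / of_real (s\<^sup>2))"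
      by (metis times_divide_eq_right mult.right_neutral)
    then show ?thesis
      by (simp add: algebra_simps)
  qed
  finally have eq: "w - b * of_real (\<rho>\<^sup>2) * cnj w = 
     1 / z + b * z * of_real (1 - \<rho>\<^sup>2 / s\<^sup>2) + k - b * of_real (\<rho>\<^sup>2) * (cnj b * cnj z + cnj k)" .
  have "norm (1 / z + b * z * of_real (1 - \<rho>\<^sup>2 / s\<^sup>2) + k - b * of_real (\<rho>\<^sup>2) * (cnj b * cnj z + cnj k))
     \<le> norm (1 / z) + norm (b * z * of_real (1 - \<rho>\<^sup>2 / s\<^sup>2)) + norm k + norm (b * of_real (\<rho>\<^sup>2) * (cnj b * cnj z + cnj k))"
    by (intro order.trans[OF norm_triangle_ineq4] order.trans[OF norm_triangle_ineq] add_mono order.refl)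
  also have "norm (1 / z) = 1 / s"
    by (simp add: s_def norm_divide)
  also have "norm (b * z * of_real (1 - \<rho>\<^sup>2 / s\<^sup>2)) = B * s * (1 - \<rho>\<^sup>2 / s\<^sup>2)"
  proof -
    have "0 \<le> 1 - \<rho>\<^sup>2 / s\<^sup>2"
      using s s' by (simp add: power_mono)
    then show ?thesis
      by (simp only: norm_mult norm_of_real B_def s_def abs_of_nonneg)
  qed
  also have "norm (b * of_real (\<rho>\<^sup>2) * (cnj b * cnj z + cnj k)) \<le> B * \<rho>\<^sup>2 * (B + K)"
  proof -
    have "norm (cnj b * cnj z + cnj k) \<le> B * s + K * s\<^sup>2"
      using norm_triangle_ineq[of "cnj b * cnj z" "cnj k"] k by (simp add: norm_mult B_def s_def)
    also have "\<dots> \<le> B * 1 + K * 1"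
      using s' B K by (intro add_mono mult_left_mono) (auto simp: power_le_one)
    finally show ?thesis
      using B by (auto simp: norm_mult B_def simp flip: of_real_power intro!: mult_left_mono)
  qed
  also have "norm k \<le> K * s\<^sup>2"
    using k by (simp add: s_def)
  also have "1 / s + B * s * (1 - \<rho>\<^sup>2 / s\<^sup>2) + K * s\<^sup>2 \<le> 1 / \<rho> + K * \<rho>\<^sup>2"
  proof -
    \<comment> \<open>The right side minus the left side has the factor
      \<open>1 / \<rho> - 1 / s\<close>, that is \<open>(s - \<rho>) / (s * \<rho>)\<close>. The
      cofactor is nonnegative by \<open>small\<close>, since \<open>s\<close> and
      \<open>\<rho>\<close> are at most 1.\<close>
    have "B * \<rho> * (s + \<rho>) \<le> B * \<rho> * 2" "K * \<rho> * (s * (s + \<rho>)) \<le> K * \<rho> * (1 * 2)"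
      using s s' B K by (intro mult_left_mono mult_mono; simp)+
    then have "0 \<le> 1 - B * \<rho> * (s + \<rho>) - K * \<rho> * (s * (s + \<rho>))"
      using small by (simp add: B_def algebra_simps)
    then have "0 \<le> (s - \<rho>) / (s * \<rho>) * (1 - B * \<rho> * (s + \<rho>) - K * \<rho> * (s * (s + \<rho>)))"
      using s s' by (intro mult_nonneg_nonneg divide_nonneg_pos) auto
    also have "\<dots> = 1 / \<rho> + K * \<rho>\<^sup>2 - (1 / s + B * s * (1 - \<rho>\<^sup>2 / s\<^sup>2) + K * s\<^sup>2)"
      using s s' by (simp add: field_simps power2_eq_square)
    finally show ?thesis by simp
  qed
  finally show ?thesis
    unfolding eq by (simp add: B_def algebra_simps)
qed

section \<open>Lower bound for the area, and Gronwall's inequality\<close>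

text \<open>Bessel's inequality on each circle \<open>|z| = exp x\<close>, integrated over
  \<open>x\<close>. It will be applied to \<open>z * p' - p\<close>, because the derivative of
  \<open>p (exp \<zeta>) / exp \<zeta>\<close> is this function at \<open>exp \<zeta>\<close>
  divided by \<open>exp \<zeta>\<close>.\<close>

lemma energy_log_annulus:
  assumes hol: "f holomorphic_on ball 0 1" and F: "f has_fps_expansion F" and ac: "a \<le> c" "c < 0"
  shows "integral {a..c} (\<lambda>x. 2 * pi * (\<Sum>m\<le>N. (norm (fps_nth F m))\<^sup>2 * exp x ^ (2*m)) / (exp x)\<^sup>2) \<le>
    integral {a..c} (\<lambda>x. integral {0..2*pi} (\<lambda>y. (norm (f (exp (Complex x y)) / exp (Complex x y)))\<^sup>2))"
proof (rule integral_le)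
  show "(\<lambda>x. 2 * pi * (\<Sum>m\<le>N. (norm (fps_nth F m))\<^sup>2 * exp x ^ (2*m)) / (exp x)\<^sup>2) integrable_on {a..c}"
    by (intro integrable_continuous_real continuous_intros) auto
  have "continuous_on (cbox (a, 0) (c, 2*pi)) (\<lambda>p. f (exp (Complex (fst p) (snd p))))"
    unfolding Complex_eq
    by (intro continuous_on_compose2[OF holomorphic_on_imp_continuous_on[OF hol]] continuous_intros)
       (use ac in auto)
  then have "continuous_on (cbox (a, 0) (c, 2*pi)) (\<lambda>p. (norm (f (exp (Complex (fst p) (snd p))) / exp (Complex (fst p) (snd p))))\<^sup>2)"
    unfolding Complex_eq by (intro continuous_intros) auto
  from integral_integrable_2dim[OF this]
  show "(\<lambda>x. integral {0..2*pi} (\<lambda>y. (norm (f (exp (Complex x y)) / exp (Complex x y)))\<^sup>2)) integrable_on {a..c}"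
    by simp
  fix x assume x: "x \<in> {a..c}"
  have eq: "exp (Complex x y) = of_real (exp x) * cis y" for y
    by (simp add: exp_eq_polar)
  have "2 * pi * (\<Sum>m\<le>N. (norm (fps_nth F m))\<^sup>2 * exp x ^ (2*m)) \<le>
     integral {0..2*pi} (\<lambda>y. (norm (f (of_real (exp x) * cis y)))\<^sup>2)"
    by (rule bessel_circle[OF hol F]) (use x ac in auto)
  then have "2 * pi * (\<Sum>m\<le>N. (norm (fps_nth F m))\<^sup>2 * exp x ^ (2*m)) / (exp x)\<^sup>2 \<le>
     integral {0..2*pi} (\<lambda>y. (norm (f (of_real (exp x) * cis y)))\<^sup>2) / (exp x)\<^sup>2"
    by (rule divide_right_mono) simp
  also have "\<dots> = integral {0..2*pi} (\<lambda>y. (norm (f (of_real (exp x) * cis y)))\<^sup>2 / (exp x)\<^sup>2)"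
    by simp
  also have "\<dots> = integral {0..2*pi} (\<lambda>y. (norm (f (exp (Complex x y)) / exp (Complex x y)))\<^sup>2)"
    unfolding eq by (simp add: norm_divide norm_mult power_divide)
  finally show "2 * pi * (\<Sum>m\<le>N. (norm (fps_nth F m))\<^sup>2 * exp x ^ (2*m)) / (exp x)\<^sup>2 \<le> \<dots>" .
qed

text \<open>
  Logarithmic coordinates \<^term>\<open>exp \<zeta>\<close> make the annulus a rectangle. The twist by
  \<open>\<beta> = b\<^sub>2 \<rho>\<^sup>2\<close> cancels the term \<open>b\<^sub>2 z\<close> on the circle \<open>|z| = \<rho>\<close>; bounding the image by a
  disc without it would only give the area inequality with a constant larger than 1.
\<close>
lemma area_theorem:
  assumes hol: "p holomorphic_on ball 0 1" and P: "p has_fps_expansion P" and P0: "fps_nth P 0 = 1"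
    and inj: "inj_on (\<lambda>z. p z / z) (ball 0 1 - {0})"
  shows "(\<Sum>m=2..N. (real m - 1) * (norm (fps_nth P m))\<^sup>2) \<le> 1"
proof -
  define b where "b = fps_nth P"
  define \<Phi> where "\<Phi> = (\<lambda>z. z * deriv p z - p z)"
  define A where "A = (\<lambda>s. \<Sum>m\<le>N. (real m - 1) * (norm (b m))\<^sup>2 * s ^ (2 * m))"
  define T where "T = (\<Sum>m=2..N. (real m - 1) * (norm (b m))\<^sup>2)"
  \<comment> \<open>Subtracting \<open>b 1\<close> translates the image, which changes neither its
    area nor injectivity, and leaves the expansion \<open>1 / z + b 2 * z + ...\<close> with
    \<open>z = exp \<zeta>\<close>.\<close>
  define h where "h = (\<lambda>\<zeta>. p (exp \<zeta>) / exp \<zeta> - b 1)"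
  define I where "I = (\<lambda>a c. integral {a..c} (\<lambda>x. integral {0..2*pi} (\<lambda>y. (norm (deriv h (Complex x y)))\<^sup>2)))"
  define B where "B = norm (b 2)"
  have sums: "(\<lambda>n. b n * z ^ n) sums p z" if "norm z < 1" for z
    unfolding b_def by (rule sums_taylor[OF hol P that])
  \<comment> \<open>The pole term \<open>m = 0\<close> contributes -1 and the term
    \<open>m = 1\<close> vanishes. This -1 becomes the bound 1 of the conclusion.\<close>
  have A_eq: "A s = (\<Sum>m=2..N. (real m - 1) * (norm (b m))\<^sup>2 * s ^ (2 * m)) - 1" for s
  proof -
    have "{..N} - {1} = insert 0 {2..N}" by auto
    moreover have "A s = (\<Sum>m\<in>{..N} - {1}. (real m - 1) * (norm (b m))\<^sup>2 * s ^ (2 * m))"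
      unfolding A_def by (intro sum.mono_neutral_right) auto
    ultimately show ?thesis
      by (simp add: b_def P0)
  qed
  have der_h: "deriv h \<zeta> = \<Phi> (exp \<zeta>) / exp \<zeta>" and hol_h: "h holomorphic_on {\<zeta>. Re \<zeta> < 0}" 
    if "Re \<zeta> < 0" for \<zeta>
  proof -
    have "(h has_field_derivative \<Phi> (exp \<zeta>) / exp \<zeta>) (at \<zeta>)" if "Re \<zeta> < 0" for \<zeta>
    proof -
      have "(p has_field_derivative deriv p (exp \<zeta>)) (at (exp \<zeta>))"
        using that by (intro holomorphic_derivI[OF hol]) auto
      then have "((\<lambda>\<zeta>. p (exp \<zeta>)) has_field_derivative deriv p (exp \<zeta>) * exp \<zeta>) (at \<zeta>)"
        by (rule DERIV_chain2) (rule DERIV_exp)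
      then show ?thesis
        unfolding h_def \<Phi>_def by (auto intro!: derivative_eq_intros simp: field_simps)
    qed
    then show "deriv h \<zeta> = \<Phi> (exp \<zeta>) / exp \<zeta>" "h holomorphic_on {\<zeta>. Re \<zeta> < 0}" 
      using that by (auto intro!: DERIV_imp_deriv simp: holomorphic_on_open open_halfspace_Re_lt)
  qed
  \<comment> \<open>\<open>pi * A (exp x) / (exp x)^2\<close> is an antiderivative of the Bessel
    bound: differentiating the exponential with exponent \<open>(2 * m - 2) * x\<close> turns the
    weight \<open>m - 1\<close> into \<open>2 * (m - 1)^2\<close>, and \<open>z * p' - p\<close> has
    coefficients \<open>(m - 1) * b m\<close>.\<close>
  have lower: "pi * (A (exp c) / (exp c)\<^sup>2 - A (exp a) / (exp a)\<^sup>2) \<le> I a c" if ac: "a \<le> c" "c < 0" for a c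
  proof -
    define D where "D = fps_X * fps_deriv P - P"
    have D: "\<Phi> has_fps_expansion D"
      unfolding \<Phi>_def D_def by (intro fps_expansion_intros P)
    have D_nth: "fps_nth D m = (of_nat m - 1) * b m" for m
      by (cases m) (simp_all add: D_def b_def algebra_simps)
    have norm_D: "(norm (fps_nth D m))\<^sup>2 = (real m - 1)\<^sup>2 * (norm (b m))\<^sup>2" for m
    proof -
      have "norm (of_nat m - 1 :: complex) = \<bar>real m - 1\<bar>"
        by (metis norm_of_real of_real_1 of_real_diff of_real_of_nat_eq)
      then show ?thesis
        by (simp add: D_nth norm_mult power_mult_distrib)
    qed
    have "\<Phi> holomorphic_on ball 0 1"
      unfolding \<Phi>_def by (intro holomorphic_intros hol) auto
    have pw: "exp x ^ k / (exp x)\<^sup>2 = exp ((real k - 2) * x)" for x :: real and k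
      by (simp add: exp_diff left_diff_distrib exp_of_nat_mult flip: exp_double)
    have A_exp: "pi * (A (exp x) / (exp x)\<^sup>2) = (\<Sum>m\<le>N. pi * (real m - 1) * (norm (b m))\<^sup>2 * exp ((2 * real m - 2) * x))" for x
      using pw[of x "2 * _"]
      by (simp add: A_def sum_divide_distrib sum_distrib_left mult.assoc flip: times_divide_eq_right)
    have "((\<lambda>x. pi * (A (exp x) / (exp x)\<^sup>2)) has_real_derivative 
       2 * pi * (\<Sum>m\<le>N. (norm (fps_nth D m))\<^sup>2 * exp x ^ (2*m)) / (exp x)\<^sup>2) (at x)" for x
    proof -
      have "((\<lambda>x. pi * (A (exp x) / (exp x)\<^sup>2)) has_real_derivative 
         (\<Sum>m\<le>N. pi * (real m - 1) * (norm (b m))\<^sup>2 * (exp ((2 * real m - 2) * x) * (2 * real m - 2)))) (at x)"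
        unfolding A_exp by (auto intro!: derivative_eq_intros sum.cong)
      also have "(\<Sum>m\<le>N. pi * (real m - 1) * (norm (b m))\<^sup>2 * (exp ((2 * real m - 2) * x) * (2 * real m - 2))) = 
         (\<Sum>m\<le>N. 2 * pi * ((norm (fps_nth D m))\<^sup>2 * (exp x ^ (2*m) / (exp x)\<^sup>2)))"
        unfolding norm_D pw by (intro sum.cong) (auto simp: power2_eq_square algebra_simps)
      finally show ?thesis
        by (simp add: sum_distrib_left sum_divide_distrib mult.assoc)
    qed
    then have "((\<lambda>x. 2 * pi * (\<Sum>m\<le>N. (norm (fps_nth D m))\<^sup>2 * exp x ^ (2*m)) / (exp x)\<^sup>2) has_integral
        (pi * (A (exp c) / (exp c)\<^sup>2) - pi * (A (exp a) / (exp a)\<^sup>2))) {a..c}"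
      using ac by (intro fundamental_theorem_of_calculus)
        (auto simp flip: has_real_derivative_iff_has_vector_derivative intro: DERIV_subset)
    then have "pi * (A (exp c) / (exp c)\<^sup>2 - A (exp a) / (exp a)\<^sup>2) = 
       integral {a..c} (\<lambda>x. 2 * pi * (\<Sum>m\<le>N. (norm (fps_nth D m))\<^sup>2 * exp x ^ (2*m)) / (exp x)\<^sup>2)"
      by (simp add: has_integral_integrable_integral right_diff_distrib)
    also have "\<dots> \<le> integral {a..c} (\<lambda>x. integral {0..2*pi} (\<lambda>y. (norm (\<Phi> (exp (Complex x y)) / exp (Complex x y)))\<^sup>2))"
      by (rule energy_log_annulus) fact+
    also have "\<dots> = I a c"
      unfolding I_def using ac by (intro integral_cong) (simp add: der_h)
    finally show ?thesis .
  qed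
  have AR: "A R \<le> 0" if R: "0 < R" "R < 1" for R
  proof -
    obtain K where K: "0 \<le> K" "\<And>z. norm z \<le> R \<Longrightarrow> norm (p z - (\<Sum>n<3. b n * z ^ n)) \<le> K * norm z ^ 3"
      using powser_remainder_bound[OF sums R] by metis
    define C where "C = K + B * (B + K)"
    have C: "0 \<le> C"
      using K by (simp add: C_def B_def)
    \<comment> \<open>The lower and upper bounds for \<open>I a c\<close> are compared. The singular
      term \<open>1 / \<rho>^2\<close> occurs with coefficient 1 on both sides and cancels; this is
      where the sharp constant is decided.\<close>
    have main: "(1 - B\<^sup>2 * \<rho> ^ 4) * (A R / R\<^sup>2 - \<rho>\<^sup>2 * T) - B\<^sup>2 * \<rho>\<^sup>2 \<le> 2 * C * \<rho> + C\<^sup>2 * \<rho> ^ 4" 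
      if \<rho>: "0 < \<rho>" "\<rho> < R" "2 * (B + K) * \<rho> \<le> 1" "B * \<rho>\<^sup>2 < 1" for \<rho>
    proof -
      define a c where "a = ln \<rho>" and "c = ln R"
      have ac: "a < c" "c < 0" "exp a = \<rho>" "exp c = R"
        using R \<rho> by (auto simp: a_def c_def)
      have small: "norm (b 2 * of_real (\<rho>\<^sup>2)) = B * \<rho>\<^sup>2"
        by (simp add: B_def norm_mult norm_power)
      have "(1 - (norm (b 2 * of_real (\<rho>\<^sup>2)))\<^sup>2) * I a c \<le> pi * (1 / \<rho> + C * \<rho>\<^sup>2)\<^sup>2"
        unfolding I_def
      proof (rule area_twisted_image_le[where U = "{\<zeta>. Re \<zeta> < 0}"])
        show "h holomorphic_on {\<zeta>. Re \<zeta> < 0}"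
          by (rule hol_h[of "-1"]) simp
        show "open {\<zeta>. Re \<zeta> < 0}"
          by (rule open_halfspace_Re_lt)
        show "Complex x y \<in> {\<zeta>. Re \<zeta> < 0}" if "x \<in> {a..c}" for x y
          using that ac by auto
        show "norm (b 2 * of_real (\<rho>\<^sup>2)) < 1"
          unfolding small by (rule \<rho>)
        show "0 \<le> 1 / \<rho> + C * \<rho>\<^sup>2"
          using \<rho> C by simp
        show "x = x' \<and> y = y'" 
          if "x \<in> {a<..<c}" "y \<in> {0<..<2*pi}" "x' \<in> {a<..<c}" "y' \<in> {0<..<2*pi}" 
             "h (Complex x y) = h (Complex x' y')" for x y x' y'
        proof -
          have "exp (Complex x y) = exp (Complex x' y')"
            by (rule inj_onD[OF inj]) (use that ac in \<open>auto simp: h_def\<close>)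
          \<comment> \<open>Both imaginary parts lie in the open interval from 0 to
            \<open>2 * pi\<close>, so they differ by less than a period of
            \<open>exp\<close>.\<close>
          then have "Complex x y = Complex x' y'"
            by (rule exp_complex_eqI[rotated]) (use that in auto)
          then show ?thesis by simp
        qed
        show "norm (h (Complex x y) - b 2 * of_real (\<rho>\<^sup>2) * cnj (h (Complex x y))) \<le> 1 / \<rho> + C * \<rho>\<^sup>2"
          if x: "x \<in> {a<..<c}" for x y
        proof -
          define z where "z = exp (Complex x y)"
          define k where "k = (p z - (\<Sum>n<3. b n * z ^ n)) / z"
          have "norm z = exp x"
            by (simp add: z_def)
          moreover have "exp a < exp x" "exp x < exp c"
            using x by auto
          ultimately have z: "\<rho> < norm z" "norm z < R" "z \<noteq> 0"
            using ac \<rho> by auto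
          have "norm k \<le> K * norm z ^ 3 / norm z"
            unfolding k_def norm_divide using K(2) z by (intro divide_right_mono) auto
          also have "\<dots> = K * (norm z)\<^sup>2"
            using z by (simp add: power2_eq_square power3_eq_cube)
          finally have k: "norm k \<le> K * (norm z)\<^sup>2" .
          have "h (Complex x y) = 1 / z + b 2 * z + k"
            using z P0 by (simp add: h_def k_def z_def[symmetric] b_def eval_nat_numeral field_simps)
          then show ?thesis
            using twisted_norm_bound[of \<rho> z k K "b 2"] k z \<rho> R K by (simp add: C_def B_def)
        qed
      qed
      then have upper: "(1 - B\<^sup>2 * \<rho> ^ 4) * I a c \<le> pi * (1 / \<rho> + C * \<rho>\<^sup>2)\<^sup>2"
        unfolding small by (simp add: power_mult_distrib)
      have "(B * \<rho>\<^sup>2)\<^sup>2 \<le> 1"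
        using \<rho> by (intro power_le_one) (auto simp: B_def)
      then have pos: "0 \<le> 1 - B\<^sup>2 * \<rho> ^ 4"
        by (simp add: power_mult_distrib)
      \<comment> \<open>All exponents \<open>2 * m\<close> are at least 4, so apart from the pole
        term \<open>A \<rho> / \<rho>^2\<close> is at most \<open>\<rho>^2 * T\<close>, which
        vanishes in the limit.\<close>
      have A\<rho>: "A \<rho> \<le> \<rho> ^ 4 * T - 1"
        unfolding A_eq T_def sum_distrib_left
      proof (intro diff_mono sum_mono order.refl)
        fix m assume "m \<in> {2..N}"
        then have "\<rho> ^ (2 * m) \<le> \<rho> ^ 4" "0 \<le> real m - 1"
          using \<rho> R by (auto intro!: power_decreasing)
        then show "(real m - 1) * (norm (b m))\<^sup>2 * \<rho> ^ (2 * m) \<le> \<rho> ^ 4 * ((real m - 1) * (norm (b m))\<^sup>2)"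
          by (subst mult.commute) (intro mult_right_mono; simp)
      qed
      have "(1 - B\<^sup>2 * \<rho> ^ 4) * (A R / R\<^sup>2 - (\<rho> ^ 4 * T - 1) / \<rho>\<^sup>2) \<le> (1 - B\<^sup>2 * \<rho> ^ 4) * (A R / R\<^sup>2 - A \<rho> / \<rho>\<^sup>2)"
        using A\<rho> by (intro mult_left_mono pos diff_mono divide_right_mono) auto
      also have "pi * \<dots> \<le> (1 - B\<^sup>2 * \<rho> ^ 4) * I a c"
        using mult_left_mono[OF lower[of a c] pos] ac by (simp add: mult_ac)
      also note upper
      finally have "(1 - B\<^sup>2 * \<rho> ^ 4) * (A R / R\<^sup>2 - (\<rho> ^ 4 * T - 1) / \<rho>\<^sup>2) \<le> (1 / \<rho> + C * \<rho>\<^sup>2)\<^sup>2"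
        by simp
      moreover have "(1 - B\<^sup>2 * \<rho> ^ 4) * (A R / R\<^sup>2 - (\<rho> ^ 4 * T - 1) / \<rho>\<^sup>2) =
         (1 - B\<^sup>2 * \<rho> ^ 4) * (A R / R\<^sup>2 - \<rho>\<^sup>2 * T) + (1 - B\<^sup>2 * \<rho> ^ 4) * (1 / \<rho>\<^sup>2)"
        unfolding distrib_left[symmetric] using \<rho> by (simp add: field_simps)
      moreover have "(1 - B\<^sup>2 * \<rho> ^ 4) * (1 / \<rho>\<^sup>2) = 1 / \<rho>\<^sup>2 - B\<^sup>2 * \<rho>\<^sup>2"
        using \<rho> by (simp add: field_simps)
      moreover have "(1 / \<rho> + C * \<rho>\<^sup>2)\<^sup>2 = 1 / \<rho>\<^sup>2 + 2 * C * \<rho> + C\<^sup>2 * \<rho> ^ 4"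
        using \<rho> by (simp add: field_simps power2_eq_square eval_nat_numeral)
      ultimately show ?thesis
        by linarith
    qed
    \<comment> \<open>Letting \<open>\<rho>\<close> tend to 0 with \<open>R\<close> fixed leaves
      \<open>A R / R^2 \<le> 0\<close>.\<close>
    have "((\<lambda>\<rho>. (1 - B\<^sup>2 * \<rho> ^ 4) * (A R / R\<^sup>2 - \<rho>\<^sup>2 * T) - B\<^sup>2 * \<rho>\<^sup>2) \<longlongrightarrow> 
        (1 - B\<^sup>2 * 0 ^ 4) * (A R / R\<^sup>2 - 0\<^sup>2 * T) - B\<^sup>2 * 0\<^sup>2) (at_right 0)"
      by (intro tendsto_intros)
    moreover have "((\<lambda>\<rho>. 2 * C * \<rho> + C\<^sup>2 * \<rho> ^ 4) \<longlongrightarrow> 2 * C * 0 + C\<^sup>2 * 0 ^ 4) (at_right 0)"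
      by (intro tendsto_intros)
    moreover have "eventually (\<lambda>\<rho>. 0 < \<rho> \<and> \<rho> < R \<and> 2 * (B + K) * \<rho> < 1 \<and> B * \<rho>\<^sup>2 < 1) (at_right 0)"
    proof -
      have "((\<lambda>\<rho>. 2 * (B + K) * \<rho>) \<longlongrightarrow> 2 * (B + K) * 0) (at_right 0)" 
           "((\<lambda>\<rho>. B * \<rho>\<^sup>2) \<longlongrightarrow> B * 0\<^sup>2) (at_right 0)"
        by (intro tendsto_intros)+
      then have "eventually (\<lambda>\<rho>. 2 * (B + K) * \<rho> < 1) (at_right 0)" "eventually (\<lambda>\<rho>. B * \<rho>\<^sup>2 < 1) (at_right 0)"
        by (auto dest: order_tendstoD(2)[where a = 1])
      moreover have "eventually (\<lambda>\<rho>. \<rho> \<in> {0<..<R}) (at_right 0)"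
        using R(1) by (rule eventually_at_right_real)
      ultimately show ?thesis
        by eventually_elim auto
    qed
    then have "eventually (\<lambda>\<rho>. (1 - B\<^sup>2 * \<rho> ^ 4) * (A R / R\<^sup>2 - \<rho>\<^sup>2 * T) - B\<^sup>2 * \<rho>\<^sup>2 \<le> 2 * C * \<rho> + C\<^sup>2 * \<rho> ^ 4) (at_right 0)"
      by eventually_elim (use main in auto)
    ultimately have "(1 - B\<^sup>2 * 0 ^ 4) * (A R / R\<^sup>2 - 0\<^sup>2 * T) - B\<^sup>2 * 0\<^sup>2 \<le> 2 * C * 0 + C\<^sup>2 * 0 ^ 4"
      by (intro tendsto_le[OF trivial_limit_at_right_real])
    then show ?thesis
      using R by (simp add: divide_le_0_iff)
  qed
  \<comment> \<open>\<open>A\<close> is a polynomial, so its sign passes to the limit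
    \<open>R = 1\<close>, where \<open>A 1 \<le> 0\<close> is the claim.\<close>
  have "(A \<longlongrightarrow> A 1) (at_left 1)"
    unfolding A_def by (intro tendsto_intros)
  moreover have "eventually (\<lambda>R. A R \<le> 0) (at_left 1)"
  proof -
    have "eventually (\<lambda>R. R \<in> {0<..<1}) (at_left (1::real))"
      by (rule eventually_at_left_real) simp
    then show ?thesis
      by eventually_elim (use AR in auto)
  qed
  ultimately have "A 1 \<le> 0"
    by (intro tendsto_upperbound) auto
  then show ?thesis
    by (simp add: A_eq b_def)
qed

section \<open>The radius of the class \<open>\<U>\<close>\<close>

text \<open>Partial fractions in \<open>1 - r^2\<close>. In this form every term is visibly
  increasing on \<open>[0, 1)\<close>, and each is the sum of a standard power series in
  \<open>r^2\<close>, up to the constant.\<close>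

lemma radius_fun_eq:
  assumes "\<bar>r\<bar> < 1"
  shows "radius_fun r = 1 / (1 - r\<^sup>2)\<^sup>2 + 1 / (1 - r\<^sup>2) - 2 - ln (1 - r\<^sup>2)"
proof -
  have "r\<^sup>2 < 1"
    using assms by (simp add: abs_square_less_1)
  then have "1 - r\<^sup>2 \<noteq> 0" by simp
  have "1 / (1 - r\<^sup>2) = (1 - r\<^sup>2) / (1 - r\<^sup>2)\<^sup>2"
    using \<open>1 - r\<^sup>2 \<noteq> 0\<close> by (simp add: power2_eq_square)
  moreover have "2 = 2 * (1 - r\<^sup>2)\<^sup>2 / (1 - r\<^sup>2)\<^sup>2"
    using \<open>1 - r\<^sup>2 \<noteq> 0\<close> by simp
  ultimately have "1 / (1 - r\<^sup>2)\<^sup>2 + 1 / (1 - r\<^sup>2) - 2 = (1 + (1 - r\<^sup>2) - 2 * (1 - r\<^sup>2)\<^sup>2) / (1 - r\<^sup>2)\<^sup>2"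
    by (metis add_divide_distrib diff_divide_distrib)
  also have "1 + (1 - r\<^sup>2) - 2 * (1 - r\<^sup>2)\<^sup>2 = 3 * r\<^sup>2 - 2 * r ^ 4"
    by (simp add: power2_eq_square eval_nat_numeral algebra_simps)
  finally show ?thesis
    by (simp add: radius_fun_def)
qed

lemma radius_fun_strict_mono:
  assumes "0 \<le> r" "r < s" "s < 1"
  shows "radius_fun r < radius_fun s"
proof -
  have lt: "1 - s\<^sup>2 < 1 - r\<^sup>2" and pos: "0 < 1 - s\<^sup>2"
    using assms by (auto simp: power_strict_mono abs_square_less_1)
  have "1 / (1 - r\<^sup>2) < 1 / (1 - s\<^sup>2)"
    using lt pos by (intro divide_strict_left_mono) auto
  moreover have "1 / (1 - r\<^sup>2)\<^sup>2 \<le> 1 / (1 - s\<^sup>2)\<^sup>2"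
    using lt pos by (intro divide_left_mono power_mono) auto
  moreover have "ln (1 - s\<^sup>2) \<le> ln (1 - r\<^sup>2)"
    using lt pos by simp
  ultimately show ?thesis
    using assms by (simp add: radius_fun_eq)
qed

lemma radius_fun_root_exists:
  assumes "0 < A"
  shows "\<exists>r\<in>{0<..<1}. radius_fun r = A"
proof -
  \<comment> \<open>Chosen so that \<open>1 / (1 - s^2) = A + 2\<close>; then
    \<open>radius_fun s\<close> is an explicit expression in \<open>A\<close> that exceeds
    \<open>A\<close>, as the intermediate value theorem needs.\<close>
  define s where "s = sqrt (1 - 1 / (A + 2))"
  have s2: "1 - s\<^sup>2 = 1 / (A + 2)"
    using assms by (simp add: s_def)
  have s: "0 \<le> s" "s < 1"
    using assms by (auto simp: s_def)
  have "A \<le> (A + 2)\<^sup>2 + (A + 2) - 2 + ln (A + 2)"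
    using assms by simp
  also have "\<dots> = radius_fun s"
    using s assms by (simp add: radius_fun_eq s2 power_one_over ln_div field_simps)
  finally have "A \<le> radius_fun s" .
  moreover have "continuous_on {0..s} radius_fun"
  proof -
    have "1 - r\<^sup>2 > 0" if "r \<in> {0..s}" for r
      using that s by (simp add: abs_square_less_1)
    then show ?thesis
      unfolding radius_fun_def by (intro continuous_intros) force+
  qed
  ultimately obtain r where "0 \<le> r" "r \<le> s" "radius_fun r = A"
    using IVT'[of radius_fun 0 A s] assms s by (auto simp: radius_fun_def)
  moreover from this have "r \<noteq> 0"
    using assms by (auto simp: radius_fun_def)
  ultimately show ?thesis
    using s by force
qed

text \<open>With \<open>n = k + 1\<close> the weight is
  \<open>(k + 1)^2 / k = (k + 1) + 1 + 1 / k\<close>, which splits the sum into the differentiated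
  geometric, the geometric and the logarithmic series in \<open>r^2\<close>.\<close>

lemma weight_sum_le_radius_fun:
  assumes r: "0 \<le> r" "r < 1"
  shows "(\<Sum>n=2..N. (real n)\<^sup>2 / (real n - 1) * (r ^ (n - 1))\<^sup>2) \<le> radius_fun r"
proof -
  define x where "x = r\<^sup>2"
  have x: "0 \<le> x" "x < 1"
    using r by (auto simp: x_def abs_square_less_1)
  define t where "t = (\<lambda>k. real (Suc k) * x ^ k + x ^ k + x ^ k / real k)"
  have "(\<lambda>k. real (Suc k) * x ^ k) sums (1 / (1 - x)\<^sup>2)" "(\<lambda>k. x ^ k) sums (1 / (1 - x))"
    using geometric_deriv_sums[of x] geometric_sums[of x] x by auto
  moreover have "(\<lambda>k. x ^ k / real k) sums - ln (1 - x)"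
    using sums_minus[OF ln_series'[of "- x"]] x by simp
  ultimately have t: "t sums (1 / (1 - x)\<^sup>2 + 1 / (1 - x) + - ln (1 - x))"
    unfolding t_def by (intro sums_add)
  have "(\<Sum>n=2..N. (real n)\<^sup>2 / (real n - 1) * (r ^ (n - 1))\<^sup>2) = (\<Sum>n=2..N. t (n - 1))"
  proof (intro sum.cong refl)
    fix n assume "n \<in> {2..N}"
    then obtain k where n: "n = Suc k" "0 < k"
      by (cases n) auto
    have "(r ^ k)\<^sup>2 = x ^ k"
      unfolding x_def by (metis power_mult mult.commute)
    with n show "(real n)\<^sup>2 / (real n - 1) * (r ^ (n - 1))\<^sup>2 = t (n - 1)"
      by (simp add: t_def field_simps power2_eq_square)
  qed
  also have "\<dots> = (\<Sum>k\<in>{1..<N}. t k)"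
    by (rule sum.reindex_bij_witness[of _ Suc "\<lambda>n. n - 1"]) auto
  \<comment> \<open>Here \<open>t 0 = 2\<close>, because the quotient \<open>x ^ 0 / 0\<close>
    counts as 0. Adding this term accounts for the -2 in \<open>radius_fun_eq\<close>.\<close>
  also have "\<dots> + t 0 = (\<Sum>k\<in>insert 0 {1..<N}. t k)"
    by simp
  also have "\<dots> \<le> 1 / (1 - x)\<^sup>2 + 1 / (1 - x) + - ln (1 - x)"
    unfolding sums_unique[OF t]
    by (rule sum_le_suminf[OF sums_summable[OF t]]) (use x in \<open>auto simp: t_def\<close>)
  also have "\<dots> = radius_fun r + 2"
    using r by (simp add: radius_fun_eq x_def)
  finally show ?thesis
    by (simp add: t_def)
qed

text \<open>
  Used with \<open>a = b\<^sub>1 z\<close>, \<open>d = z e'\<close>, when the quotient is \<open>(z / g z)\<^sup>2 g' z\<close>.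
\<close>
lemma perturbed_U_bound:
  fixes a d e :: complex
  assumes "norm (d - 2 * e) + 2 * norm e < norm a"
  shows "a + e \<noteq> 0" and "norm (a * (a + d) / (a + e)\<^sup>2 - 1) < 1"
proof -
  have e: "norm e < norm a" and a: "0 < norm a"
    using assms norm_ge_zero[of "d - 2 * e"] norm_ge_zero[of e] by linarith+
  have le: "norm a - norm e \<le> norm (a + e)"
    by (metis add.commute norm_diff_ineq)
  then show ne: "a + e \<noteq> 0"
    using e by auto
  have "a * (a + d) - (a + e)\<^sup>2 = a * (d - 2 * e) - e\<^sup>2"
    by (simp add: power2_eq_square algebra_simps)
  then have "norm (a * (a + d) - (a + e)\<^sup>2) \<le> norm a * norm (d - 2 * e) + (norm e)\<^sup>2"
    by (metis norm_mult norm_power norm_triangle_ineq4)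
  \<comment> \<open>Replacing \<open>norm (d - 2 * e)\<close> by its bound
    \<open>norm a - 2 * norm e\<close> completes the square of
    \<open>norm a - norm e\<close>.\<close>
  also have "\<dots> < norm a * (norm a - 2 * norm e) + (norm e)\<^sup>2"
    using assms a by (intro add_strict_right_mono mult_strict_left_mono) auto
  also have "\<dots> = (norm a - norm e)\<^sup>2"
    by (simp add: power2_eq_square algebra_simps)
  also have "\<dots> \<le> (norm (a + e))\<^sup>2"
    using le e by (intro power_mono) auto
  finally have "norm (a * (a + d) - (a + e)\<^sup>2) < norm ((a + e)\<^sup>2)"
    by (simp add: norm_power)
  moreover have "a * (a + d) / (a + e)\<^sup>2 - 1 = (a * (a + d) - (a + e)\<^sup>2) / (a + e)\<^sup>2"
    using ne by (simp add: diff_divide_distrib)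
  ultimately show "norm (a * (a + d) / (a + e)\<^sup>2 - 1) < 1"
    using ne by (simp add: norm_divide)
qed

section \<open>The quotient z / f z of a univalent function\<close>

text \<open>Injectivity and \<open>f 0 = 0\<close> make \<open>f z / z\<close>, extended by
  \<open>f'(0) = 1\<close>, zero-free, so its reciprocal is holomorphic. Dividing
  \<open>z_over f z\<close> by \<open>z\<close> gives \<open>1 / f z\<close>, which inherits
  injectivity from \<open>f\<close>.\<close>

lemma z_over_class_S:
  assumes f: "f \<in> class_S"
  shows z_over_holomorphic: "z_over f holomorphic_on ball 0 1"
    and z_over_coeff_0: "taylor_coeff (z_over f) 0 = 1"
    and z_over_coeff_1: "taylor_coeff (z_over f) 1 = - taylor_coeff f 2"
    and z_over_inj: "inj_on (\<lambda>z. z_over f z / z) (ball 0 1 - {0})"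
proof -
  have hol: "f holomorphic_on ball 0 1" and f0: "f 0 = 0" and f1: "deriv f 0 = 1"
    and inj: "inj_on f (ball 0 1)"
    using f by (auto simp: class_S_def class_A_def analytic_imp_holomorphic)
  define F where "F = (\<lambda>z. if z = 0 then 1 else f z / z)"
  define A where "A = fps_expansion f 0"
  have nz: "f z \<noteq> 0" if "z \<in> ball 0 1 - {0}" for z
    using inj_onD[OF inj, of z 0] that f0 by auto
  have z_over: "z_over f = (\<lambda>z. inverse (F z))"
    by (auto simp: z_over_def F_def)
  have F_hol: "F holomorphic_on ball 0 1"
    using pole_lemma_open[OF hol open_ball, of 0] by (simp add: F_def f0 f1 cong: if_cong)
  show hol_p: "z_over f holomorphic_on ball 0 1"
    unfolding z_over by (intro holomorphic_intros F_hol) (use nz in \<open>auto simp: F_def\<close>)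
  have A: "f has_fps_expansion A"
    unfolding A_def by (rule has_fps_expansion_fps_expansion[OF open_ball _ hol]) simp
  have A01: "fps_nth A 0 = 0" "fps_nth A 1 = 1"
    by (auto simp: fps_nth_fps_expansion[OF A] f0 f1)
  then have "1 \<le> subdegree A"
    by (intro subdegree_geI) auto
  then have "(\<lambda>z. if z = 0 then 1 else f z / z ^ 1) has_fps_expansion fps_shift 1 A"
    by (rule has_fps_expansion_shift[OF A]) (simp only: A01)
  then have "F has_fps_expansion fps_shift 1 A"
    by (simp add: F_def cong: if_cong)
  then have "z_over f has_fps_expansion inverse (fps_shift 1 A)"
    unfolding z_over by (rule has_fps_expansion_inverse) (use A01 in simp)
  moreover have "z_over f has_fps_expansion fps_expansion (z_over f) 0"
    by (rule has_fps_expansion_fps_expansion[OF open_ball _ hol_p]) simp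
  ultimately have P: "fps_expansion (z_over f) 0 = inverse (fps_shift 1 A)"
    using fps_nth_fps_expansion by (metis fps_ext)
  have "inverse (fps_shift 1 A) * fps_shift 1 A = 1"
    using A01 by (intro inverse_mult_eq_1) simp
  \<comment> \<open>The coefficient of \<open>z\<close> in the product of the two reciprocal series
    is the first coefficient of \<open>z_over f\<close> plus that of \<open>f z / z\<close>, which
    is the second one of \<open>f\<close>.\<close>
  then have "fps_nth (inverse (fps_shift 1 A) * fps_shift 1 A) 1 = 0"
    by simp
  with A01 show "taylor_coeff (z_over f) 0 = 1" "taylor_coeff (z_over f) 1 = - taylor_coeff f 2"
    unfolding P by (simp_all add: A_def[symmetric] numeral_2_eq_2 eq_neg_iff_add_eq_0 add.commute)
  show "inj_on (\<lambda>z. z_over f z / z) (ball 0 1 - {0})"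
    using inj nz by (auto simp: inj_on_def z_over_def)
qed

theorem theorem3:
  fixes f :: "complex \<Rightarrow> complex"
  assumes "f \<in> class_S"
    and "taylor_coeff f 2 \<noteq> 0"
  shows "(\<exists>!r0. r0 \<in> {0<..<1} \<and> radius_fun r0 = (norm (taylor_coeff f 2))\<^sup>2) \<and>
         (\<forall>r0. r0 \<in> {0<..<1} \<and> radius_fun r0 = (norm (taylor_coeff f 2))\<^sup>2 \<longrightarrow>
            (\<lambda>z. (z_over f z - 1) / (- taylor_coeff f 2)) \<in> class_U_in_disc r0)"
proof (intro conjI allI impI)
  show "\<exists>!r0. r0 \<in> {0<..<1} \<and> radius_fun r0 = (norm (taylor_coeff f 2))\<^sup>2"
  proof (rule ex_ex1I)
    show "\<exists>r0. r0 \<in> {0<..<1} \<and> radius_fun r0 = (norm (taylor_coeff f 2))\<^sup>2"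
      using radius_fun_root_exists[of "(norm (taylor_coeff f 2))\<^sup>2"] assms(2) by auto
    show "r = s" if "r \<in> {0<..<1} \<and> radius_fun r = (norm (taylor_coeff f 2))\<^sup>2"
      "s \<in> {0<..<1} \<and> radius_fun s = (norm (taylor_coeff f 2))\<^sup>2" for r s
      using that radius_fun_strict_mono[of r s] radius_fun_strict_mono[of s r]
      by (cases r s rule: linorder_cases) auto
  qed
next
  fix r0 assume "r0 \<in> {0<..<1} \<and> radius_fun r0 = (norm (taylor_coeff f 2))\<^sup>2"
  then have r0: "0 < r0" "r0 < 1" "radius_fun r0 = (norm (taylor_coeff f 2))\<^sup>2"
    by auto
  note One_nat_def [simp del]
  define p where "p = z_over f"
  define P where "P = fps_expansion p 0"
  define b where "b = fps_nth P"
  define g where "g = (\<lambda>z. (p z - 1) / b 1)"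
  have hol: "p holomorphic_on ball 0 1"
    unfolding p_def by (rule z_over_holomorphic[OF assms(1)])
  have P: "p has_fps_expansion P"
    unfolding P_def by (rule has_fps_expansion_fps_expansion[OF open_ball _ hol]) simp
  have b0: "b 0 = 1" and b1: "b 1 = - taylor_coeff f 2"
    unfolding b_def P_def p_def by (rule z_over_coeff_0[OF assms(1)] z_over_coeff_1[OF assms(1)])+
  have b1_nz: "b 1 \<noteq> 0"
    unfolding b1 using assms(2) by simp
  have area: "(\<Sum>n=2..N. (real n - 1) * (norm (b n))\<^sup>2) \<le> 1" for N
    unfolding b_def 
    by (rule area_theorem[OF hol P]) (use b0 z_over_inj[OF assms(1)] in \<open>auto simp: b_def p_def\<close>)
  have p0: "p 0 = 1" and dp0: "deriv p 0 = b 1"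
    using fps_nth_fps_expansion[OF P, of 0] fps_nth_fps_expansion[OF P, of 1] b0 by (auto simp: b_def One_nat_def)
  have der_g: "deriv g z = deriv p z / b 1" if "norm z < 1" for z
  proof -
    have "(p has_field_derivative deriv p z) (at z)"
      using that by (intro holomorphic_derivI[OF hol]) auto
    then have "(g has_field_derivative deriv p z / b 1) (at z)"
      unfolding g_def using b1_nz by (auto intro!: derivative_eq_intros)
    then show ?thesis
      by (rule DERIV_imp_deriv)
  qed
  have "g \<in> class_A"
  proof -
    have "g holomorphic_on ball 0 1"
      unfolding g_def using b1_nz by (intro holomorphic_intros hol) auto
    then have "g analytic_on ball 0 1"
      by (simp add: analytic_on_open)
    then show ?thesis
      using b1_nz by (simp add: class_A_def der_g dp0) (simp add: g_def p0)
  qed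
  moreover have "g z \<noteq> 0 \<and> norm ((z_over g z)\<^sup>2 * deriv g z - 1) < 1" if z: "0 < norm z" "norm z < r0" for z
  proof -
    define r where "r = norm z"
    define Q where "Q = sqrt (radius_fun r)"
    define e where "e = p z - 1 - b 1 * z"
    define d where "d = z * deriv p z - b 1 * z"
    have r: "0 < r" "r < 1" "r < r0"
      using z r0 by (auto simp: r_def)
    have Q: "Q < norm (b 1)"
    proof -
      have "radius_fun r < (norm (b 1))\<^sup>2"
        unfolding b1 using radius_fun_strict_mono[of r r0] r r0 by simp
      then show ?thesis
        unfolding Q_def by (simp add: real_less_lsqrt)
    qed
    have u: "(\<Sum>n=2..N. real n * norm (b n) * r ^ n) \<le> r * Q" for N
    proof -
      define u where "u = (\<Sum>n=2..N. real n * norm (b n) * r ^ (n - 1))"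
      \<comment> \<open>Splitting for Cauchy-Schwarz: the first factor carries the weight
        \<open>n - 1\<close> of the area theorem, the second the weight \<open>n^2 / (n - 1)\<close>
        that sums to \<open>radius_fun r\<close>.\<close>
      have "u = (\<Sum>n=2..N. (sqrt (real n - 1) * norm (b n)) * (real n / sqrt (real n - 1) * r ^ (n - 1)))"
        unfolding u_def by (intro sum.cong) auto
      also have "\<dots>\<^sup>2 \<le> (\<Sum>n=2..N. (sqrt (real n - 1) * norm (b n))\<^sup>2) * (\<Sum>n=2..N. (real n / sqrt (real n - 1) * r ^ (n - 1))\<^sup>2)"
        by (rule Cauchy_Schwarz_ineq_sum)
      also have "(\<Sum>n=2..N. (sqrt (real n - 1) * norm (b n))\<^sup>2) = (\<Sum>n=2..N. (real n - 1) * (norm (b n))\<^sup>2)"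
        by (intro sum.cong) (auto simp: power_mult_distrib)
      also have "(\<Sum>n=2..N. (real n / sqrt (real n - 1) * r ^ (n - 1))\<^sup>2) = (\<Sum>n=2..N. (real n)\<^sup>2 / (real n - 1) * (r ^ (n - 1))\<^sup>2)"
        by (intro sum.cong) (auto simp: power_mult_distrib power_divide)
      also have "(\<Sum>n=2..N. (real n - 1) * (norm (b n))\<^sup>2) * \<dots> \<le> 1 * radius_fun r"
        using r by (intro mult_mono area weight_sum_le_radius_fun sum_nonneg) auto
      finally have "u \<le> Q"
        unfolding Q_def by (intro real_le_rsqrt) simp
      moreover have "(\<Sum>n=2..N. real n * norm (b n) * r ^ n) = r * u"
        unfolding u_def sum_distrib_left
      proof (intro sum.cong refl)
        fix n assume "n \<in> {2..N}"
        then have "r ^ n = r * r ^ (n - 1)"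
          by (simp add: power_eq_if)
        then show "real n * norm (b n) * r ^ n = r * (real n * norm (b n) * r ^ (n - 1))"
          by simp
      qed
      ultimately show ?thesis
        using r by simp
    qed
    have z1: "norm z < 1"
      using r by (simp add: r_def)
    \<comment> \<open>From index 2 on these are the terms of \<open>d - 2 * e\<close> and of
      \<open>e\<close>: since \<open>d\<close> is \<open>z * e'\<close>, its coefficients are
      \<open>n * b n\<close>.\<close>
    define x y where "x = (\<lambda>n. (of_nat n - 2) * b n * z ^ n)" and "y = (\<lambda>n. b n * z ^ n)"
    have "y sums p z"
      unfolding y_def b_def by (rule sums_taylor[OF hol P z1])
    moreover have "(\<Sum>n<2. y n) = 1 + b 1 * z"
      by (simp add: y_def b0 lessThan_nat_numeral)
    moreover have "p z - (1 + b 1 * z) = e"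
      by (simp add: e_def)
    ultimately have y: "(\<lambda>n. y (n + 2)) sums e"
      by (metis sums_split_initial_segment)
    define D where "D = fps_X * fps_deriv P - fps_const 2 * P"
    have D: "(\<lambda>z. z * deriv p z - 2 * p z) has_fps_expansion D"
      unfolding D_def by (intro fps_expansion_intros P)
    have D_nth: "fps_nth D n = (of_nat n - 2) * b n" for n
      by (cases n) (simp_all add: D_def b_def One_nat_def algebra_simps)
    have "(\<lambda>z. z * deriv p z - 2 * p z) holomorphic_on ball 0 1"
      by (intro holomorphic_intros hol) auto
    from sums_taylor[OF this D z1] have "x sums (z * deriv p z - 2 * p z)"
      by (simp only: x_def D_nth)
    moreover have "(\<Sum>n<2. x n) = - 2 - b 1 * z"
      by (simp add: x_def b0 lessThan_nat_numeral)
    moreover have "z * deriv p z - 2 * p z - (- 2 - b 1 * z) = d - 2 * e"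
      by (simp add: e_def d_def algebra_simps)
    ultimately have x: "(\<lambda>n. x (n + 2)) sums (d - 2 * e)"
      by (metis sums_split_initial_segment)
    have "norm (d - 2 * e) + 2 * norm e \<le> r * Q"
    proof (rule LIMSEQ_le_const2)
      show "(\<lambda>N. norm (\<Sum>n<N. x (n + 2)) + 2 * norm (\<Sum>n<N. y (n + 2))) \<longlonglongrightarrow> norm (d - 2 * e) + 2 * norm e"
        using x y unfolding sums_def by (intro tendsto_intros)
      have "norm (\<Sum>n<N. x (n + 2)) + 2 * norm (\<Sum>n<N. y (n + 2)) \<le> r * Q" for N
      proof -
        have "norm (\<Sum>n<N. x (n + 2)) + 2 * norm (\<Sum>n<N. y (n + 2)) \<le> 
            (\<Sum>n<N. norm (x (n + 2))) + 2 * (\<Sum>n<N. norm (y (n + 2)))"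
          by (intro add_mono mult_left_mono norm_sum) auto
        also have "\<dots> = (\<Sum>n<N. norm (x (n + 2)) + 2 * norm (y (n + 2)))"
          by (simp add: sum.distrib sum_distrib_left)
        \<comment> \<open>For an index \<open>m \<ge> 2\<close> the moduli of the factors
          \<open>m - 2\<close> and 2 add up to exactly \<open>m\<close>.\<close>
        also have "\<dots> = (\<Sum>n<N. real (n + 2) * norm (b (n + 2)) * r ^ (n + 2))"
          by (intro sum.cong refl) (simp add: x_def y_def r_def norm_mult norm_power algebra_simps)
        also have "\<dots> = (\<Sum>n=2..N+1. real n * norm (b n) * r ^ n)"
          by (rule sum.reindex_bij_witness[of _ "\<lambda>n. n - 2" "\<lambda>n. n + 2"]) auto
        also have "\<dots> \<le> r * Q"
          by (rule u)
        finally show ?thesis .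
      qed
      then show "\<exists>N. \<forall>n\<ge>N. norm (\<Sum>n<n. x (n + 2)) + 2 * norm (\<Sum>n<n. y (n + 2)) \<le> r * Q"
        by blast
    qed
    also have "\<dots> < norm (b 1 * z)"
      using Q r by (simp add: norm_mult r_def mult.commute)
    finally have small: "norm (d - 2 * e) + 2 * norm e < norm (b 1 * z)" .
    have g: "g z = (b 1 * z + e) / b 1"
      by (simp add: g_def e_def)
    have "(z_over g z)\<^sup>2 * deriv g z = b 1 * z * (b 1 * z + d) / (b 1 * z + e)\<^sup>2"
      using z b1_nz by (simp add: z_over_def g der_g[OF z1] d_def power_divide power2_eq_square)
    then show ?thesis
      using perturbed_U_bound[OF small] b1_nz by (simp add: g)
  qed
  \<comment> \<open>The centre is treated apart, because the strict inequality behind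
    \<open>perturbed_U_bound\<close> degenerates at 0. There \<open>z_over g 0 = 1\<close> and
    \<open>deriv g 0 = 1\<close>, so the norm is 0.\<close>
  moreover have "norm ((z_over g 0)\<^sup>2 * deriv g 0 - 1) < 1"
    using b1_nz by (simp add: z_over_def der_g dp0)
  ultimately have "g \<in> class_U_in_disc r0"
    unfolding class_U_in_disc_def by (auto simp: all_conj_distrib) (metis zero_less_norm_iff)
  then show "(\<lambda>z. (z_over f z - 1) / (- taylor_coeff f 2)) \<in> class_U_in_disc r0"
    by (simp only: g_def p_def b1)
qed

end
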